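(* A functional $\Theta$ satisfying $\textsf{SFF}(\Theta)$ can be computed from $\exists^3$.
   Context: The metatheory is $\textsf{ZFC}$ and functionals live in the full (set-theoretic) type structure over $\mathbb{N}$. "Computable" (in given functionals) means Kleene computable via the schemes S1–S9. For $f\in\mathbb{N}^{\mathbb{N}}$, $\overline{f}N=\langle f(0),\dots,f(N-1)\rangle$; for a finite sequence $\sigma$, $f\in[\sigma]$ means $f$ extends $\sigma$. A functional $\Theta$ of type $2\to1^*$ assigns to every $G:\mathbb{N}^{\mathbb{N}}\to\mathbb{N}$ a finite sequence $\Theta(G)=\langle f_0,\dots,f_k\rangle$ of elements of $\mathbb{N}^{\mathbb{N}}$. $\textsf{SFF}(\Theta)$ ("$\Theta$ is a special fan functional") is the statement: for all $G:\mathbb{N}^{\mathbb{N}}\to\mathbb{N}$ and all $f\in2^{\mathbb{N}}$ there is an entry $g$ of $\Theta(G)$ with $f\in[\overline{g}G(g)]$. That such a $\Theta$ is computable means that the (suitably coded) map giving the length of $\Theta(G)$ and the values $\Theta(G)(i)(n)$ is computable. $\exists^3$ is the functional of type 3 which, for every $Y:\mathbb{N}^{\mathbb{N}}\to\mathbb{N}$, satisfies $\exists^3(Y)=0$ if and only if $(\exists f\in\mathbb{N}^{\mathbb{N}})(Y(f)=0)$ (and $\exists^3(Y)=1$ otherwise). *)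

theory Defs
  imports Main "HOL-Library.Nat_Bijection"
begin

type_synonym type1 = "nat \<Rightarrow> nat"
type_synonym type2 = "type1 \<Rightarrow> nat"
type_synonym type3 = "type2 \<Rightarrow> nat"

text \<open>
  Kleene's schemes S1--S9 over the full type structure, for arguments of pure type at most 3.
  The only scheme that introduces new arguments of type above 0 is S8, which from an argument of
  type \<open>j\<close> produces one of type \<open>j - 2\<close>; so computations whose inputs have type at most 3
  never leave this fragment.

  As in Kleene's original presentation the arguments are grouped by type, and only the order
  within each type matters: \<open>xs\<close>, \<open>fs\<close>, \<open>Gs\<close>, \<open>Hs\<close> list the arguments of type 0, 1, 2, 3.
  Indices are numbers coded by the primitive recursive bijection \<^const>\<open>list_encode\<close>; since the
  arguments are passed as explicit lists, indices do not carry a signature.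
  \<open>kleene e xs fs Gs Hs v\<close> means that \<open>{e}(xs, fs, Gs, Hs)\<close> is defined with value \<open>v\<close>.
  In S8 the premise for all \<open>x\<close> (all \<open>f\<close>) says that the abstracted function is total.
  S9 is \<open>{e'}(e, b, c) = {e}(b)\<close>; the index \<open>e'\<close> records how many arguments of each type form \<open>b\<close>.
\<close>

definition to_front :: "nat \<Rightarrow> 'a list \<Rightarrow> 'a list" where
  "to_front k as = as ! k # take k as @ drop (Suc k) as"

inductive kleene ::
  "nat \<Rightarrow> nat list \<Rightarrow> type1 list \<Rightarrow> type2 list \<Rightarrow> type3 list \<Rightarrow> nat \<Rightarrow> bool"
where
  S1: "kleene (list_encode [1]) (x # xs) fs Gs Hs (Suc x)"
| S2: "kleene (list_encode [2, q]) xs fs Gs Hs q"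
| S3: "kleene (list_encode [3]) (x # xs) fs Gs Hs x"
| S4: "\<lbrakk>kleene h xs fs Gs Hs u; kleene g (u # xs) fs Gs Hs v\<rbrakk>
       \<Longrightarrow> kleene (list_encode [4, g, h]) xs fs Gs Hs v"
| S5_0: "kleene g xs fs Gs Hs v
       \<Longrightarrow> kleene (list_encode [5, g, h]) (0 # xs) fs Gs Hs v"
| S5_Suc: "\<lbrakk>kleene (list_encode [5, g, h]) (x # xs) fs Gs Hs u;
            kleene h (x # u # xs) fs Gs Hs v\<rbrakk>
       \<Longrightarrow> kleene (list_encode [5, g, h]) (Suc x # xs) fs Gs Hs v"
| S6_0: "\<lbrakk>k < length xs; kleene g (to_front k xs) fs Gs Hs v\<rbrakk>
       \<Longrightarrow> kleene (list_encode [6, 0, k, g]) xs fs Gs Hs v"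
| S6_1: "\<lbrakk>k < length fs; kleene g xs (to_front k fs) Gs Hs v\<rbrakk>
       \<Longrightarrow> kleene (list_encode [6, 1, k, g]) xs fs Gs Hs v"
| S6_2: "\<lbrakk>k < length Gs; kleene g xs fs (to_front k Gs) Hs v\<rbrakk>
       \<Longrightarrow> kleene (list_encode [6, 2, k, g]) xs fs Gs Hs v"
| S6_3: "\<lbrakk>k < length Hs; kleene g xs fs Gs (to_front k Hs) v\<rbrakk>
       \<Longrightarrow> kleene (list_encode [6, 3, k, g]) xs fs Gs Hs v"
| S7: "kleene (list_encode [7]) (x # xs) (f # fs) Gs Hs (f x)"
| S8_2: "(\<And>x. kleene h (x # xs) fs (G # Gs) Hs (F x))
       \<Longrightarrow> kleene (list_encode [8, 2, h]) xs fs (G # Gs) Hs (G F)"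
| S8_3: "(\<And>f. kleene h xs (f # fs) Gs (H # Hs) (Y f))
       \<Longrightarrow> kleene (list_encode [8, 3, h]) xs fs Gs (H # Hs) (H Y)"
| S9: "kleene e xs fs Gs Hs v
       \<Longrightarrow> kleene (list_encode [9, length xs, length fs, length Gs, length Hs])
             (e # xs @ xs') (fs @ fs') (Gs @ Gs') (Hs @ Hs') v"

text \<open>
  A functional of type \<open>2 \<rightarrow> 1\<^sup>*\<close> is computable from \<open>H\<close> if its length function and its
  (totalised by 0) entry function are.
\<close>

definition seq_functional_computable_from ::
  "(type2 \<Rightarrow> type1 list) \<Rightarrow> type3 \<Rightarrow> bool" where
  "seq_functional_computable_from \<Theta> H \<longleftrightarrow>
     (\<exists>e. \<forall>G. kleene e [] [] [G] [H] (length (\<Theta> G))) \<and>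
     (\<exists>e. \<forall>G i n. kleene e [i, n] [] [G] [H] (if i < length (\<Theta> G) then (\<Theta> G ! i) n else 0))"

definition initial_segment :: "type1 \<Rightarrow> nat \<Rightarrow> nat list" where
  "initial_segment f N = map f [0..<N]"

definition cylinder :: "nat list \<Rightarrow> type1 set" where
  "cylinder \<sigma> = {f. initial_segment f (length \<sigma>) = \<sigma>}"

definition cantor_space :: "type1 set" where
  "cantor_space = {f. \<forall>n. f n \<in> {0, 1}}"

definition SFF :: "(type2 \<Rightarrow> type1 list) \<Rightarrow> bool" where
  "SFF \<Theta> \<longleftrightarrow>
     (\<forall>G. \<forall>f \<in> cantor_space. \<exists>g \<in> set (\<Theta> G). f \<in> cylinder (initial_segment g (G g)))"

definition exists3 :: type3 where
  "exists3 Y = (if \<exists>f. Y f = 0 then 0 else 1)"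

end

theory Submission
  imports Defs
begin

text \<open>
  Run through Cantor space from left to right in the lexicographic order: start with the zero
  sequence; having reached \<open>b\<close>, continue with the first point to the right of the neighbourhood
  \<open>[b|G(b)]\<close>; at limits take suprema.  The points visited form a well-ordered set \<open>W\<close>, and the
  right-hand parts of their neighbourhoods partition Cantor space.  Each of these parts contains
  an eventually constant sequence, so \<open>W\<close> is countable, and \<open>W\<close> can be defined from \<open>G\<close> by
  quantification over \<open>\<nat>\<^sup>\<nat>\<close> alone, hence with \<open>\<exists>\<^sup>3\<close>.  Enumerating \<open>W\<close> along the eventually
  constant sequences, by compactness a finite part of the enumeration is a subcover, and
  the length of the shortest such part is found by unbounded search.
\<close>

section \<open>The lexicographic order\<close>

definition lex_less :: "type1 \<Rightarrow> type1 \<Rightarrow> bool" where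
  "lex_less x y \<longleftrightarrow> (\<exists>n. x n < y n \<and> (\<forall>m<n. x m = y m))"

lemma lex_less_irrefl: "\<not> lex_less x x"
  by (auto simp: lex_less_def)

lemma lex_less_trans:
  assumes "lex_less x y" "lex_less y z"
  shows "lex_less x z"
proof -
  obtain n where n: "x n < y n" "\<forall>m<n. x m = y m" using assms(1) by (auto simp: lex_less_def)
  obtain k where k: "y k < z k" "\<forall>m<k. y m = z m" using assms(2) by (auto simp: lex_less_def)
  have "x (min n k) < z (min n k) \<and> (\<forall>m<min n k. x m = z m)"
    using n k by (cases n k rule: linorder_cases) (auto simp: min_def)
  then show ?thesis by (auto simp: lex_less_def)
qed

lemma lex_less_asym: "lex_less x y \<Longrightarrow> \<not> lex_less y x"
  using lex_less_irrefl lex_less_trans by blast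

lemma lex_less_linear: "lex_less x y \<or> x = y \<or> lex_less y x"
proof (cases "x = y")
  case False
  then have ex: "\<exists>n. x n \<noteq> y n" by auto
  define n where "n = (LEAST n. x n \<noteq> y n)"
  have "x n \<noteq> y n" unfolding n_def using ex by (rule LeastI_ex)
  moreover have "\<forall>m<n. x m = y m" unfolding n_def using not_less_Least by blast
  ultimately show ?thesis
    unfolding lex_less_def by (metis linorder_neqE_nat)
qed simp

text \<open>Cylinders are order-convex: at the first place below \<open>k\<close> where
  \<open>y\<close> leaves the common values of \<open>x\<close> and \<open>z\<close>, it would drop
  below \<open>x\<close> or rise above \<open>z\<close>.\<close>

lemma lex_interval_agree:
  assumes "\<not> lex_less y x" "\<not> lex_less z y" and eq: "\<forall>n<k. x n = z n"
  shows "\<forall>n<k. x n = y n"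
proof -
  have "n < k \<longrightarrow> x n = y n" for n
  proof (induction n rule: less_induct)
    case (less n)
    show ?case
    proof
      assume "n < k"
      then have "\<forall>m<n. x m = y m" "\<forall>m<n. y m = z m" "x n = z n" using less eq by auto
      moreover have "\<not> y n < x n" using assms(1) calculation unfolding lex_less_def by metis
      moreover have "\<not> z n < y n" using assms(2) calculation unfolding lex_less_def by metis
      ultimately show "x n = y n" by simp
    qed
  qed
  then show ?thesis by blast
qed

text \<open>The infimum is built digit by digit: \<open>p n\<close> is the least value at
  \<open>n\<close> among the members of \<open>X\<close> that agree with \<open>p\<close> before
  \<open>n\<close>. It need not belong to \<open>X\<close>, only to its closure.\<close>

lemma lex_infimum:
  assumes "X \<noteq> {}"
  obtains p where "\<And>x. x \<in> X \<Longrightarrow> \<not> lex_less x p" "\<And>n. \<exists>x\<in>X. \<forall>m<n. x m = p m"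
proof -
  define P where "P p n v \<longleftrightarrow> (\<exists>x\<in>X. (\<forall>m<n. x m = p m) \<and> x n = v) \<and>
    (\<forall>x\<in>X. (\<forall>m<n. x m = p m) \<longrightarrow> v \<le> x n)" for p :: type1 and n v
  have "\<exists>p. \<forall>n. P p n (p n)"
  proof (rule dependent_wellorder_choice)
    fix r n and f g :: type1
    assume "\<And>y. y < n \<Longrightarrow> f y = g y"
    then show "P f n r = P g n r" by (simp add: P_def)
  next
    fix n and f :: type1
    assume IH: "\<And>y. y < n \<Longrightarrow> P f y (f y)"
    have "\<exists>x\<in>X. \<forall>m<n. x m = f m"
    proof (cases n)
      case 0
      then show ?thesis using assms by auto
    next
      case (Suc k)
      then have "P f k (f k)" using IH by simp
      then show ?thesis unfolding P_def Suc by (metis less_Suc_eq)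
    qed
    then have ex: "\<exists>v. \<exists>x\<in>X. (\<forall>m<n. x m = f m) \<and> x n = v" by auto
    show "\<exists>v. P f n v"
      unfolding P_def using LeastI_ex[OF ex]
        Least_le[of "\<lambda>v. \<exists>x\<in>X. (\<forall>m<n. x m = f m) \<and> x n = v"] by blast
  qed
  then obtain p where p: "\<And>n. P p n (p n)" by blast
  show ?thesis
  proof (rule that)
    show "\<not> lex_less x p" if "x \<in> X" for x
      using p that unfolding lex_less_def P_def by (meson not_le)
    show "\<exists>x\<in>X. \<forall>m<n. x m = p m" for n
      using p[of n] unfolding P_def by blast
  qed
qed

section \<open>Right covers\<close>

definition covers :: "type2 \<Rightarrow> type1 \<Rightarrow> type1 \<Rightarrow> bool" where
  "covers G b x \<longleftrightarrow> (\<forall>n<G b. x n = b n)"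

definition right_covers :: "type2 \<Rightarrow> type1 \<Rightarrow> type1 \<Rightarrow> bool" where
  "right_covers G b x \<longleftrightarrow> \<not> lex_less x b \<and> covers G b x"

text \<open>
  Requiring covers from the left in the second conjunct makes every good set well-ordered, so
  that goodness needs no reference to well-foundedness.
\<close>

definition good :: "type2 \<Rightarrow> type1 set \<Rightarrow> bool" where
  "good G A \<longleftrightarrow> (\<forall>a\<in>A. a \<in> cantor_space \<and>
     (\<forall>x\<in>cantor_space. lex_less x a \<longrightarrow> (\<exists>b\<in>A. right_covers G b x)) \<and>
     (\<forall>b\<in>A. lex_less b a \<longrightarrow> \<not> covers G b a))"

definition W :: "type2 \<Rightarrow> type1 set" where
  "W G = \<Union>{A. good G A}"

section \<open>Good sets and their union\<close>

lemma mem_cylinder_iff_covers: "x \<in> cylinder (initial_segment b (G b)) \<longleftrightarrow> covers G b x"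
  by (auto simp: cylinder_def initial_segment_def covers_def)

lemma cantor_space_closed:
  assumes "X \<subseteq> cantor_space" "\<And>n. \<exists>x\<in>X. \<forall>m<n. x m = p m"
  shows "p \<in> cantor_space"
proof -
  have "p n \<in> {0, 1}" for n
  proof -
    obtain x where "x \<in> X" "\<forall>m<Suc n. x m = p m" using assms(2) by blast
    then have "x \<in> cantor_space" "x n = p n" using assms(1) by auto
    then show ?thesis unfolding cantor_space_def by (metis mem_Collect_eq)
  qed
  then show ?thesis by (simp add: cantor_space_def)
qed

text \<open>An infimum \<open>p\<close> outside \<open>X\<close> would lie left of a member of
  \<open>A\<close>, so some \<open>b\<close> in \<open>A\<close> would right-cover it. A point of
  \<open>X\<close> close to \<open>p\<close> would then be covered by \<open>b\<close> from the
  left, which goodness forbids.\<close>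

lemma good_min:
  assumes A: "good G A" and X: "X \<subseteq> A" "X \<noteq> {}"
  shows "\<exists>p\<in>X. \<forall>x\<in>X. \<not> lex_less x p"
proof -
  obtain p where p: "\<And>x. x \<in> X \<Longrightarrow> \<not> lex_less x p" "\<And>n. \<exists>x\<in>X. \<forall>m<n. x m = p m"
    using lex_infimum[OF X(2)] by blast
  have pC: "p \<in> cantor_space"
    by (rule cantor_space_closed[OF _ p(2)]) (use A X(1) in \<open>auto simp: good_def\<close>)
  have "p \<in> X"
  proof (rule ccontr)
    assume "p \<notin> X"
    obtain x0 where "x0 \<in> X" using X by auto
    then have "lex_less p x0" using p(1) \<open>p \<notin> X\<close> lex_less_linear by metis
    then obtain b where b: "b \<in> A" "right_covers G b p"
      using A pC \<open>x0 \<in> X\<close> X(1) unfolding good_def by blast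
    obtain x where x: "x \<in> X" "\<forall>m<G b. x m = p m" using p(2) by blast
    have "lex_less p x" using p(1) x(1) \<open>p \<notin> X\<close> lex_less_linear by metis
    then have "lex_less b x"
      using b(2) lex_less_linear lex_less_trans unfolding right_covers_def by metis
    moreover have "covers G b x" using b(2) x(2) unfolding right_covers_def covers_def by simp
    ultimately show False using A b(1) x(1) X(1) unfolding good_def by blast
  qed
  then show ?thesis using p(1) by blast
qed

text \<open>Take for \<open>c\<close> a member of \<open>A\<close> that right-covers
  \<open>b\<close>. It differs from \<open>b\<close>, hence lies left of it; as it covers
  \<open>b\<close>, it cannot belong to \<open>A'\<close>.\<close>

lemma good_step:
  assumes "good G A" "good G A'" "a \<in> A" "b \<in> A'" "lex_less b a" "b \<notin> A"
  obtains c where "c \<in> A" "lex_less c b" "c \<notin> A'"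
proof -
  have "b \<in> cantor_space" using assms unfolding good_def by blast
  then obtain c where c: "c \<in> A" "right_covers G c b" using assms unfolding good_def by blast
  then have "lex_less c b" using lex_less_linear assms(6) unfolding right_covers_def by metis
  moreover have "c \<notin> A'"
    using assms(2,4) c(2) \<open>lex_less c b\<close> unfolding good_def right_covers_def by blast
  ultimately show ?thesis using that c by blast
qed

text \<open>From a leftmost counterexample \<open>p\<close>, \<open>good_step\<close> and then
  \<open>good_step\<close> with the two sets exchanged lead to a counterexample further
  left.\<close>

lemma good_initial:
  assumes "good G A" "good G A'" "a \<in> A" "b \<in> A'" "lex_less b a"
  shows "b \<in> A"
proof (rule ccontr)
  assume "b \<notin> A"
  define X where "X = {b \<in> A'. b \<notin> A \<and> (\<exists>a\<in>A. lex_less b a)}"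
  have X: "x \<in> X \<longleftrightarrow> x \<in> A' \<and> x \<notin> A \<and> (\<exists>a\<in>A. lex_less x a)" for x
    by (simp add: X_def)
  have "b \<in> X" unfolding X using assms(3-5) \<open>b \<notin> A\<close> by (intro conjI bexI)
  then have "X \<noteq> {}" "X \<subseteq> A'" using X by auto
  then obtain p where p: "p \<in> X" "\<And>x. x \<in> X \<Longrightarrow> \<not> lex_less x p"
    using good_min[OF assms(2), of X] by blast
  then obtain a' where a': "p \<in> A'" "p \<notin> A" "a' \<in> A" "lex_less p a'" using X by blast
  obtain c where c: "c \<in> A" "lex_less c p" "c \<notin> A'"
    using good_step[OF assms(1,2) a'(3,1,4,2)] by blast
  obtain d where d: "d \<in> A'" "lex_less d c" "d \<notin> A"
    using good_step[OF assms(2,1) a'(1) c] by blast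
  have "d \<in> X" unfolding X using c(1) d by (intro conjI bexI)
  then show False using p(2) lex_less_trans[OF d(2) c(2)] by blast
qed

text \<open>Only the clause on covers from the left compares points of different good sets;
  \<open>good_initial\<close> brings both points into one of them.\<close>

lemma good_W: "good G (W G)"
  unfolding good_def
proof (intro ballI conjI impI)
  fix a assume "a \<in> W G"
  then obtain A where A: "good G A" "a \<in> A" by (auto simp: W_def)
  show "a \<in> cantor_space" using A by (auto simp: good_def)
  show "\<exists>b\<in>W G. right_covers G b x" if x: "x \<in> cantor_space" "lex_less x a" for x
  proof -
    obtain b where "b \<in> A" "right_covers G b x" using A x unfolding good_def by blast
    then show ?thesis using A(1) by (auto simp: W_def)
  qed
  show "\<not> covers G b a" if b: "b \<in> W G" "lex_less b a" for b
  proof -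
    obtain A' where "good G A'" "b \<in> A'" using b by (auto simp: W_def)
    then have "b \<in> A" using good_initial A b(2) by blast
    then show ?thesis using A b(2) unfolding good_def by blast
  qed
qed

text \<open>Otherwise the infimum \<open>p\<close> of the points missed is missed too. Then
  \<open>p\<close> together with the part of \<open>W G\<close> to its left is good, so
  \<open>p\<close> is in \<open>W G\<close> and right-covers itself.\<close>

lemma W_right_covers:
  assumes "x \<in> cantor_space"
  shows "\<exists>b\<in>W G. right_covers G b x"
proof (rule ccontr)
  assume x: "\<not> ?thesis"
  define X where "X = {x \<in> cantor_space. \<not> (\<exists>b\<in>W G. right_covers G b x)}"
  have "X \<noteq> {}" using assms x by (auto simp: X_def)
  then obtain p where p: "\<And>x. x \<in> X \<Longrightarrow> \<not> lex_less x p" "\<And>n. \<exists>x\<in>X. \<forall>m<n. x m = p m"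
    using lex_infimum by blast
  have pC: "p \<in> cantor_space" by (rule cantor_space_closed[OF _ p(2)]) (auto simp: X_def)
  have unc: "\<not> right_covers G b p" if "b \<in> W G" for b
  proof
    assume b: "right_covers G b p"
    obtain x where x: "x \<in> X" "\<forall>m<G b. x m = p m" using p(2) by blast
    have "\<not> lex_less x b"
      using b p(1)[OF x(1)] lex_less_linear lex_less_trans unfolding right_covers_def by metis
    then have "right_covers G b x" using b x(2) by (simp add: right_covers_def covers_def)
    then show False using x(1) that by (auto simp: X_def)
  qed
  have below: "\<exists>b\<in>W G. right_covers G b x" if "x \<in> cantor_space" "lex_less x p" for x
    using p(1)[of x] that by (auto simp: X_def)
  have left: "lex_less b z" if "right_covers G b x" "lex_less x z" for b x z
    using that lex_less_linear lex_less_trans unfolding right_covers_def by metis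
  define A where "A = insert p {b \<in> W G. lex_less b p}"
  have "good G A"
    unfolding good_def
  proof (intro ballI conjI impI)
    fix a assume a: "a \<in> A"
    show "a \<in> cantor_space" using a pC good_W[of G] by (auto simp: A_def good_def)
    show "\<exists>b\<in>A. right_covers G b x" if x: "x \<in> cantor_space" "lex_less x a" for x
    proof -
      have "lex_less x p" using x(2) a lex_less_trans by (auto simp: A_def)
      then obtain b where "b \<in> W G" "right_covers G b x" using below x(1) by blast
      then show ?thesis using left[OF _ \<open>lex_less x p\<close>] by (auto simp: A_def)
    qed
    show "\<not> covers G b a" if b: "b \<in> A" "lex_less b a" for b
    proof (cases "a = p")
      case True
      then have "b \<in> W G" using b lex_less_irrefl by (auto simp: A_def)
      then show ?thesis
        using unc[of b] lex_less_asym[OF b(2)] True unfolding right_covers_def by simp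
    next
      case False
      then have "a \<in> W G" "lex_less a p" using a by (auto simp: A_def)
      moreover have "b \<in> W G"
        using b lex_less_asym[OF \<open>lex_less a p\<close>] by (auto simp: A_def)
      ultimately show ?thesis using good_W[of G] b(2) unfolding good_def by blast
    qed
  qed
  then have "p \<in> W G" by (auto simp: W_def A_def)
  then show False using unc[of p] lex_less_irrefl by (auto simp: right_covers_def covers_def)
qed

text \<open>Of two such points, the one further right lies between the other and \<open>x\<close>,
  so by convexity it is covered from the left.\<close>

lemma W_right_covers_unique:
  assumes "b \<in> W G" "b' \<in> W G" "right_covers G b x" "right_covers G b' x"
  shows "b = b'"
proof -
  have *: "\<not> lex_less b b'" if "b \<in> W G" "b' \<in> W G" "right_covers G b x" "right_covers G b' x"
    for b b'
  proof
    assume l: "lex_less b b'"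
    have "\<forall>n<G b. b n = b' n"
      using lex_interval_agree[of b' b x "G b"] that lex_less_asym[OF l]
      unfolding right_covers_def covers_def by metis
    then have "covers G b b'" by (simp add: covers_def)
    then show False using good_W[of G] that l unfolding good_def by blast
  qed
  show ?thesis using *[OF assms] *[OF assms(2,1,4,3)] lex_less_linear by blast
qed

text \<open>
  The sequences that are eventually 1; their zeros are the positions of the binary digits 1 of \<open>i\<close>.
\<close>

definition ev_one :: "nat \<Rightarrow> type1" where
  "ev_one i n = (if even (i div 2 ^ n) then 1 else 0)"

definition point :: "type2 \<Rightarrow> nat \<Rightarrow> type1" where
  "point G i = (THE b. b \<in> W G \<and> right_covers G b (ev_one i))"

lemma ev_one_in_cantor_space: "ev_one i \<in> cantor_space"
  by (simp add: cantor_space_def ev_one_def)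

text \<open>Describes the graph of \<open>point\<close>, which a formula can express without a
  description operator.\<close>

lemma point_iff: "b = point G i \<longleftrightarrow> b \<in> W G \<and> right_covers G b (ev_one i)"
proof -
  have ex: "\<exists>!b. b \<in> W G \<and> right_covers G b (ev_one i)"
    using W_right_covers[OF ev_one_in_cantor_space] W_right_covers_unique by blast
  show ?thesis using theI'[OF ex] ex unfolding point_def by blast
qed

lemma W_eq_range_point: "W G = range (point G)"
proof
  show "range (point G) \<subseteq> W G" using point_iff by blast
  show "W G \<subseteq> range (point G)"
  proof
    fix b assume b: "b \<in> W G"
    \<comment> \<open>\<open>ev_one i\<close> copies \<open>b\<close> on the first
      \<open>G b\<close> places and is 1 afterwards, so it stays in the neighbourhood of
      \<open>b\<close> and is not to the left of \<open>b\<close>.\<close>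
    define i where "i = set_encode {n. n < G b \<and> b n = 0}"
    have "set_decode i = {n. n < G b \<and> b n = 0}" unfolding i_def by simp
    then have odd: "odd (i div 2 ^ n) \<longleftrightarrow> n < G b \<and> b n = 0" for n
      unfolding set_decode_def by blast
    have b01: "b n \<in> {0, 1}" for n
      using b good_W[of G] unfolding good_def cantor_space_def by blast
    have e: "ev_one i n = (if n < G b then b n else 1)" for n
      using odd[of n] b01[of n] by (auto simp: ev_one_def)
    have "\<not> ev_one i n < b n" for n using e[of n] b01[of n] by auto
    then have "right_covers G b (ev_one i)"
      unfolding right_covers_def lex_less_def covers_def using e by auto
    then have "b = point G i" using b point_iff by blast
    then show "b \<in> range (point G)" by blast
  qed
qed

section \<open>Compactness and the finite subcover\<close>

lemma covers_compact:
  assumes cov: "\<And>x. x \<in> cantor_space \<Longrightarrow> \<exists>i. covers G (s i) x"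
  shows "\<exists>N. \<forall>x\<in>cantor_space. \<exists>i<N::nat. covers G (s i) x"
proof (rule ccontr)
  assume no: "\<not> ?thesis"
  \<comment> \<open>Koenig's argument: \<open>P p n v\<close> says that the node consisting of the
    first \<open>n\<close> values of \<open>p\<close> followed by \<open>v\<close> has no finite
    subcover. A node without one has a child without one, which yields a branch.\<close>
  define P where "P p n v \<longleftrightarrow> v \<in> {0, 1} \<and>
    \<not> (\<exists>N. \<forall>x\<in>cantor_space. (\<forall>m<n. x m = p m) \<and> x n = v \<longrightarrow> (\<exists>i<N. covers G (s i) x))"
    for p :: type1 and n v
  have "\<exists>p. \<forall>n. P p n (p n)"
  proof (rule dependent_wellorder_choice)
    fix r n and f g :: type1
    assume "\<And>y. y < n \<Longrightarrow> f y = g y"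
    then show "P f n r = P g n r" by (simp add: P_def)
  next
    fix n and f :: type1
    assume IH: "\<And>y. y < n \<Longrightarrow> P f y (f y)"
    have bad: "\<not> (\<exists>N. \<forall>x\<in>cantor_space. (\<forall>m<n. x m = f m) \<longrightarrow> (\<exists>i<N. covers G (s i) x))"
    proof (cases n)
      case 0
      then show ?thesis using no by simp
    next
      case (Suc k)
      then have "P f k (f k)" using IH by simp
      moreover have "(\<forall>m<Suc k. x m = f m) \<longleftrightarrow> (\<forall>m<k. x m = f m) \<and> x k = f k" for x
        by (auto simp: less_Suc_eq)
      ultimately show ?thesis unfolding P_def Suc by simp
    qed
    show "\<exists>v. P f n v"
    proof (rule ccontr)
      assume "\<not> ?thesis"
      then have "\<not> P f n 0" "\<not> P f n 1" by auto
      then obtain N0 N1 where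
        N: "\<And>x. x \<in> cantor_space \<Longrightarrow> \<forall>m<n. x m = f m \<Longrightarrow> x n = 0 \<Longrightarrow> \<exists>i<N0. covers G (s i) x"
           "\<And>x. x \<in> cantor_space \<Longrightarrow> \<forall>m<n. x m = f m \<Longrightarrow> x n = 1 \<Longrightarrow> \<exists>i<N1. covers G (s i) x"
        unfolding P_def by (metis insertI1 insertI2)
      have "\<exists>i<max N0 N1. covers G (s i) x" if x: "x \<in> cantor_space" "\<forall>m<n. x m = f m" for x
      proof -
        have "x n = 0 \<or> x n = 1" using x(1) by (auto simp: cantor_space_def)
        then show ?thesis using N[OF x] by (meson less_max_iff_disj)
      qed
      then show False using bad by blast
    qed
  qed
  then obtain p where p: "\<And>n. P p n (p n)" by blast
  then have "p \<in> cantor_space" by (auto simp: P_def cantor_space_def)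
  then obtain i where i: "covers G (s i) p" using cov by blast
  \<comment> \<open>Stage \<open>G (s i)\<close> of \<open>P\<close> fixes the values up to and
    including that place, so \<open>s i\<close> alone covers the whole node.\<close>
  have "\<forall>x\<in>cantor_space. (\<forall>m<G (s i). x m = p m) \<and> x (G (s i)) = p (G (s i)) \<longrightarrow>
      (\<exists>j<Suc i. covers G (s j) x)"
    using i by (auto simp: covers_def)
  then show False using p[of "G (s i)"] unfolding P_def by blast
qed

definition subcover :: "type2 \<Rightarrow> nat \<Rightarrow> bool" where
  "subcover G N \<longleftrightarrow> (\<forall>x\<in>cantor_space. \<exists>i<N. covers G (point G i) x)"

definition sfan :: "type2 \<Rightarrow> type1 list" where
  "sfan G = map (point G) [0..<LEAST N. subcover G N]"

lemma subcover_exists: "\<exists>N. subcover G N"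
  unfolding subcover_def
proof (rule covers_compact)
  fix x assume "x \<in> cantor_space"
  then obtain b where "b \<in> W G" "right_covers G b x" using W_right_covers by blast
  then show "\<exists>i. covers G (point G i) x"
    unfolding W_eq_range_point right_covers_def by blast
qed

lemma SFF_sfan: "SFF sfan"
  unfolding SFF_def mem_cylinder_iff_covers
proof (intro allI ballI)
  fix G and x assume "x \<in> cantor_space"
  moreover have "subcover G (LEAST N. subcover G N)" using subcover_exists by (rule LeastI_ex)
  ultimately show "\<exists>g\<in>set (sfan G). covers G g x"
    unfolding subcover_def sfan_def by force
qed

section \<open>A term language for computations from \<open>\<exists>\<^sup>3\<close>\<close>

text \<open>
  De Bruijn terms: \<open>xs\<close> and \<open>fs\<close> are the environments of number and function variables.
  \<open>GApp\<close>, \<open>Let\<close> bind a number, \<open>Ex\<close> binds a function, and the last argument of \<open>Rec\<close> binds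
  the predecessor and the previous value.  As formulas, terms are true when their value is 0.
\<close>

datatype tm = Var nat | Const nat | Succ tm | FApp nat tm | GApp tm | Ex tm | Let tm tm
  | Rec tm tm tm

primrec val :: "type2 \<Rightarrow> tm \<Rightarrow> nat list \<Rightarrow> type1 list \<Rightarrow> nat" where
  "val G (Var i) xs fs = xs ! i"
| "val G (Const c) xs fs = c"
| "val G (Succ t) xs fs = Suc (val G t xs fs)"
| "val G (FApp j t) xs fs = (fs ! j) (val G t xs fs)"
| "val G (GApp t) xs fs = G (\<lambda>x. val G t (x # xs) fs)"
| "val G (Ex t) xs fs = exists3 (\<lambda>f. val G t xs (f # fs))"
| "val G (Let s t) xs fs = val G t (val G s xs fs # xs) fs"
| "val G (Rec t g h) xs fs =
     rec_nat (val G g xs fs) (\<lambda>x u. val G h (x # u # xs) fs) (val G t xs fs)"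

primrec scoped :: "nat \<Rightarrow> nat \<Rightarrow> tm \<Rightarrow> bool" where
  "scoped m k (Var i) \<longleftrightarrow> i < m"
| "scoped m k (Const c) \<longleftrightarrow> True"
| "scoped m k (Succ t) \<longleftrightarrow> scoped m k t"
| "scoped m k (FApp j t) \<longleftrightarrow> j < k \<and> scoped m k t"
| "scoped m k (GApp t) \<longleftrightarrow> scoped (Suc m) k t"
| "scoped m k (Ex t) \<longleftrightarrow> scoped m (Suc k) t"
| "scoped m k (Let s t) \<longleftrightarrow> scoped m k s \<and> scoped (Suc m) k t"
| "scoped m k (Rec t g h) \<longleftrightarrow> scoped m k t \<and> scoped m k g \<and> scoped (Suc (Suc m)) k h"

text \<open>S4, S5 and S8 put the new argument in front, so De Bruijn environments are the argument
  lists themselves; S6 only serves to fetch a variable.\<close>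

primrec index :: "tm \<Rightarrow> nat" where
  "index (Var i) = list_encode [6, 0, i, list_encode [3]]"
| "index (Const c) = list_encode [2, c]"
| "index (Succ t) = list_encode [4, list_encode [1], index t]"
| "index (FApp j t) = list_encode [4, list_encode [6, 1, j, list_encode [7]], index t]"
| "index (GApp t) = list_encode [8, 2, index t]"
| "index (Ex t) = list_encode [8, 3, index t]"
| "index (Let s t) = list_encode [4, index t, index s]"
| "index (Rec t g h) = list_encode [4, list_encode [5, index g, index h], index t]"

text \<open>The totality premises of S8 hold because \<open>val\<close> assigns a value to a term in
  every environment.\<close>

lemma kleene_index:
  "scoped (length xs) (length fs) t \<Longrightarrow>
     kleene (index t) xs fs [G] [exists3] (val G t xs fs)"
proof (induction t arbitrary: xs fs)
  case (Var i)
  then show ?case unfolding index.simps val.simps to_front_def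
    by (intro S6_0) (auto simp only: to_front_def scoped.simps append_Cons intro: S3)
next
  case (Const c)
  then show ?case unfolding index.simps val.simps by (rule_tac S2)
next
  case (Succ t)
  then show ?case unfolding index.simps val.simps by (auto intro!: S4 S1 simp only: scoped.simps)
next
  case (FApp j t)
  show ?case unfolding index.simps val.simps
  proof (rule S4)
    show "kleene (index t) xs fs [G] [exists3] (val G t xs fs)"
      using FApp by simp
    show "kleene (list_encode [6, 1, j, list_encode [7]]) (val G t xs fs # xs) fs [G] [exists3]
      ((fs ! j) (val G t xs fs))"
      using FApp.prems by (intro S6_1) (auto simp only: to_front_def scoped.simps append_Cons intro: S7)
  qed
next
  case (GApp t)
  then show ?case unfolding index.simps val.simps by (intro S8_2) simp
next
  case (Ex t)
  then show ?case unfolding index.simps val.simps by (intro S8_3) simp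
next
  case (Let s t)
  then show ?case unfolding index.simps val.simps by (intro S4) auto
next
  case (Rec t g h)
  have "kleene (list_encode [5, index g, index h]) (n # xs) fs [G] [exists3]
    (rec_nat (val G g xs fs) (\<lambda>x u. val G h (x # u # xs) fs) n)" for n
  proof (induction n)
    case 0
    have "kleene (index g) xs fs [G] [exists3] (val G g xs fs)" using Rec by simp
    then show ?case by (simp only: nat.rec) (rule S5_0)
  next
    case (Suc n)
    show ?case
      unfolding nat.rec using Suc by (rule S5_Suc) (use Rec in simp)
  qed
  then show ?case unfolding index.simps val.simps using Rec by (intro S4) auto
qed

text \<open>Lets the test of a search run while the search carries its own index as a further
  argument.\<close>

lemma scoped_mono: "scoped m k t \<Longrightarrow> m \<le> m' \<Longrightarrow> scoped m' k t"
  by (induction t arbitrary: m m' k) auto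

section \<open>Arithmetic as terms\<close>

definition Add :: "tm \<Rightarrow> tm \<Rightarrow> tm" where "Add s t = Rec s t (Succ (Var 1))"
definition Pred :: "tm \<Rightarrow> tm" where "Pred t = Rec t (Const 0) (Var 0)"
definition Sub :: "tm \<Rightarrow> tm \<Rightarrow> tm" where "Sub s t = Rec t s (Pred (Var 1))"
definition Triangle :: "tm \<Rightarrow> tm" where
  "Triangle t = Rec t (Const 0) (Add (Var 1) (Succ (Var 0)))"
definition Encode_pair :: "tm \<Rightarrow> tm \<Rightarrow> tm" where
  "Encode_pair s t = Add (Triangle (Add s t)) s"
text \<open>Uses that half of n + 1 is n minus half of n, rounding down, which avoids a parity
  test.\<close>

definition Half :: "tm \<Rightarrow> tm" where "Half t = Rec t (Const 0) (Sub (Var 0) (Var 1))"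
text \<open>The inner recursion halves repeatedly; the outer one finds the parity by flipping
  between 1 and 0.\<close>

definition Ev_one :: "tm \<Rightarrow> tm \<Rightarrow> tm" where
  "Ev_one s t = Rec (Rec t s (Half (Var 1))) (Const 1) (Sub (Const 1) (Var 1))"

lemma val_Add [simp]: "val G (Add s t) xs fs = val G s xs fs + val G t xs fs"
proof -
  have "rec_nat b (\<lambda>x u. Suc u) n = n + b" for b n by (induction n) auto
  then show ?thesis by (simp add: Add_def)
qed

lemma val_Pred [simp]: "val G (Pred t) xs fs = val G t xs fs - 1"
  by (cases "val G t xs fs") (auto simp: Pred_def)

lemma val_Sub [simp]: "val G (Sub s t) xs fs = val G s xs fs - val G t xs fs"
proof -
  have "rec_nat b (\<lambda>x u. u - 1) n = b - n" for b n by (induction n) auto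
  then show ?thesis by (simp add: Sub_def)
qed

lemma val_Encode_pair [simp]:
  "val G (Encode_pair s t) xs fs = prod_encode (val G s xs fs, val G t xs fs)"
proof -
  have "rec_nat 0 (\<lambda>x u. Suc (u + x)) n = triangle n" for n by (induction n) auto
  then show ?thesis by (simp add: Encode_pair_def Triangle_def prod_encode_def)
qed

lemma val_Ev_one [simp]: "val G (Ev_one s t) xs fs = ev_one (val G s xs fs) (val G t xs fs)"
proof -
  have half: "rec_nat 0 (\<lambda>x u. x - u) n = n div 2" for n :: nat
  proof (induction n)
    case (Suc n)
    have "n - n div 2 = Suc n div 2" by presburger
    then show ?case using Suc by simp
  qed simp
  have iter: "rec_nat b (\<lambda>x u. u div 2) n = b div 2 ^ n" for b n :: nat
    by (induction n) (auto simp: div_mult2_eq[symmetric] mult.commute)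
  have par: "rec_nat 1 (\<lambda>x u. 1 - u) n = (if even n then 1 else 0 :: nat)" for n
    by (induction n) auto
  show ?thesis using par by (simp add: Ev_one_def Half_def half iter ev_one_def)
qed

lemma scoped_arith [simp]:
  "scoped m k (Add s t) \<longleftrightarrow> scoped m k s \<and> scoped m k t"
  "scoped m k (Sub s t) \<longleftrightarrow> scoped m k s \<and> scoped m k t"
  "scoped m k (Encode_pair s t) \<longleftrightarrow> scoped m k s \<and> scoped m k t"
  "scoped m k (Ev_one s t) \<longleftrightarrow> scoped m k s \<and> scoped m k t"
  by (auto simp: Add_def Sub_def Pred_def Encode_pair_def Triangle_def Ev_one_def Half_def)

section \<open>Formulas as terms\<close>

definition Neg :: "tm \<Rightarrow> tm" where "Neg t = Rec t (Const 1) (Const 0)"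
text \<open>\<open>Add\<close> doubles as conjunction, since a sum vanishes only if both summands
  do.\<close>

definition Imp :: "tm \<Rightarrow> tm \<Rightarrow> tm" where "Imp s t = Neg (Add s (Neg t))"
definition All :: "tm \<Rightarrow> tm" where "All t = Neg (Ex (Neg t))"
definition Less :: "tm \<Rightarrow> tm \<Rightarrow> tm" where "Less s t = Sub (Succ s) t"
definition Eq :: "tm \<Rightarrow> tm \<Rightarrow> tm" where "Eq s t = Add (Sub s t) (Sub t s)"

text \<open>
  Number quantifiers are function quantifiers of which only the value at 0 is used; so they
  also shift the function variables.
\<close>

definition ExN :: "tm \<Rightarrow> tm" where "ExN t = Ex (Let (FApp 0 (Const 0)) t)"
definition AllN :: "tm \<Rightarrow> tm" where "AllN t = Neg (ExN (Neg t))"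

definition holds :: "type2 \<Rightarrow> tm \<Rightarrow> nat list \<Rightarrow> type1 list \<Rightarrow> bool" where
  "holds G t xs fs \<longleftrightarrow> val G t xs fs = 0"

lemma val_Neg: "val G (Neg t) xs fs = (if holds G t xs fs then 1 else 0)"
  by (cases "val G t xs fs") (auto simp: Neg_def holds_def)

lemma holds_simps [simp]:
  "holds G (Add s t) xs fs \<longleftrightarrow> holds G s xs fs \<and> holds G t xs fs"
  "holds G (Neg t) xs fs \<longleftrightarrow> \<not> holds G t xs fs"
  "holds G (Imp s t) xs fs \<longleftrightarrow> (holds G s xs fs \<longrightarrow> holds G t xs fs)"
  "holds G (Ex t) xs fs \<longleftrightarrow> (\<exists>f. holds G t xs (f # fs))"
  "holds G (All t) xs fs \<longleftrightarrow> (\<forall>f. holds G t xs (f # fs))"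
  "holds G (Less s t) xs fs \<longleftrightarrow> val G s xs fs < val G t xs fs"
  "holds G (Eq s t) xs fs \<longleftrightarrow> val G s xs fs = val G t xs fs"
proof -
  show neg: "holds G (Neg t) xs fs \<longleftrightarrow> \<not> holds G t xs fs" for t xs fs
    using val_Neg unfolding holds_def by simp
  show ex: "holds G (Ex t) xs fs \<longleftrightarrow> (\<exists>f. holds G t xs (f # fs))" for t xs fs
    by (simp add: holds_def exists3_def)
  show and': "holds G (Add s t) xs fs \<longleftrightarrow> holds G s xs fs \<and> holds G t xs fs" for s t xs fs
    by (simp add: holds_def)
  show "holds G (Imp s t) xs fs \<longleftrightarrow> (holds G s xs fs \<longrightarrow> holds G t xs fs)"
    by (simp add: Imp_def neg and')
  show "holds G (All t) xs fs \<longleftrightarrow> (\<forall>f. holds G t xs (f # fs))"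
    by (simp add: All_def neg ex)
  show "holds G (Less s t) xs fs \<longleftrightarrow> val G s xs fs < val G t xs fs"
    "holds G (Eq s t) xs fs \<longleftrightarrow> val G s xs fs = val G t xs fs"
    by (auto simp: holds_def Less_def Eq_def)
qed

text \<open>The premise makes the truth of \<open>t\<close> independent of the dummy function
  \<open>f\<close>. Every number is the value at 0 of a constant function.\<close>

lemma holds_ExN:
  assumes "\<And>n f. holds G t (n # xs) (f # fs) \<longleftrightarrow> P n"
  shows "holds G (ExN t) xs fs \<longleftrightarrow> (\<exists>n. P n)"
proof -
  have "holds G (ExN t) xs fs \<longleftrightarrow> (\<exists>f. holds G t (f 0 # xs) (f # fs))"
    unfolding ExN_def holds_simps by (simp add: holds_def)
  also have "\<dots> \<longleftrightarrow> (\<exists>f :: type1. P (f 0))" using assms by simp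
  also have "\<dots> \<longleftrightarrow> (\<exists>n. P n)"
  proof
    assume "\<exists>n. P n"
    then obtain n where "P n" ..
    then show "\<exists>f :: type1. P (f 0)" by (intro exI[of _ "\<lambda>_. n"])
  qed auto
  finally show ?thesis .
qed

lemma holds_AllN:
  assumes "\<And>n f. holds G t (n # xs) (f # fs) \<longleftrightarrow> P n"
  shows "holds G (AllN t) xs fs \<longleftrightarrow> (\<forall>n. P n)"
proof -
  have "holds G (ExN (Neg t)) xs fs \<longleftrightarrow> (\<exists>n. \<not> P n)"
    by (rule holds_ExN) (simp add: assms)
  then show ?thesis by (simp add: AllN_def)
qed

lemma scoped_logic [simp]:
  "scoped m k (Neg t) \<longleftrightarrow> scoped m k t"
  "scoped m k (Imp s t) \<longleftrightarrow> scoped m k s \<and> scoped m k t"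
  "scoped m k (All t) \<longleftrightarrow> scoped m (Suc k) t"
  "scoped m k (Less s t) \<longleftrightarrow> scoped m k s \<and> scoped m k t"
  "scoped m k (Eq s t) \<longleftrightarrow> scoped m k s \<and> scoped m k t"
  "scoped m k (ExN t) \<longleftrightarrow> scoped (Suc m) (Suc k) t"
  "scoped m k (AllN t) \<longleftrightarrow> scoped (Suc m) (Suc k) t"
  by (auto simp: Neg_def Imp_def All_def Less_def Eq_def ExN_def AllN_def)

section \<open>Unbounded search\<close>

lemma kleene_Least:
  assumes t: "scoped 1 0 t" "\<And>G n ys. holds G t (n # ys) [] \<longleftrightarrow> P G n"
    and ex: "\<And>G. \<exists>n. P G n"
  shows "\<exists>e. \<forall>G xs. kleene e xs [] [G] [exists3] (LEAST n. P G n)"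
proof -
  text \<open>
    \<open>p\<close> takes arguments \<open>n, e\<close>; it returns \<open>n\<close> if \<open>P G n\<close> holds, and calls \<open>{e}(n + 1, e)\<close>
    otherwise. The search is \<open>{p}(0, p)\<close>.
  \<close>
  define call where "call = list_encode [9, 2, 0, 1, 1]"
  \<comment> \<open>S5 enters with \<open>a, b, n, e\<close>, where \<open>a\<close> and
    \<open>b\<close> are its own data. As S4 pushes in front, the arguments of \<open>call\<close>
    are prepared last one first: \<open>e\<close>, then n + 1, then the index
    \<open>e\<close>.\<close>
  define again where "again =
    list_encode [4, list_encode [4, list_encode [4, call, index (Var 1)], index (Succ (Var 3))],
      index (Var 3)]"
  \<comment> \<open>Double negation normalises the test to 0 or 1, so S5 acts as a case distinction.
    At 0 it never evaluates \<open>again\<close>, which ends the search.\<close>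
  define p where "p = list_encode [4, list_encode [5, index (Var 0), again], index (Neg (Neg t))]"
  define start where "start =
    list_encode [4, list_encode [4, list_encode [4, call, index (Const p)], index (Const 0)],
      index (Const p)]"
  have call: "kleene call (e # x # y # ys) [] [G] [exists3] v"
    if "kleene e [x, y] [] [G] [exists3] v" for e x y ys G v
    using S9[OF that, of ys "[]" "[]" "[]"]
    by (simp add: call_def numeral_2_eq_2 del: list_encode.simps)
  have again: "kleene again [a, b, n, e] [] [G] [exists3] v"
    if "kleene e [Suc n, e] [] [G] [exists3] v" for a b n e G v
  proof -
    have "kleene (index (Var 3)) [a, b, n, e] [] [G] [exists3] e"
      using kleene_index[of "[a, b, n, e]" "[]" "Var 3" G]
      by (simp add: numeral_3_eq_3 del: index.simps)
    moreover have "kleene (index (Succ (Var 3))) [e, a, b, n, e] [] [G] [exists3] (Suc n)"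
      using kleene_index[of "[e, a, b, n, e]" "[]" "Succ (Var 3)" G]
      by (simp add: numeral_3_eq_3 del: index.simps)
    moreover have "kleene (index (Var 1)) [Suc n, e, a, b, n, e] [] [G] [exists3] e"
      using kleene_index[of "[Suc n, e, a, b, n, e]" "[]" "Var 1" G]
      by (simp del: index.simps)
    ultimately show ?thesis
      unfolding again_def using call[OF that] by (intro S4)
  qed
  have p: "kleene p [n, p] [] [G] [exists3] (LEAST n. P G n)" if "n \<le> (LEAST n. P G n)" for n G
    using that
  \<comment> \<open>Downward induction from the least witness: the call at \<open>n\<close> is
    defined because the one at n + 1 is.\<close>
  proof (induction n rule: inc_induct)
    case base
    let ?N = "LEAST n. P G n"
    have "P G ?N" using ex by (rule LeastI_ex)
    then have "val G (Neg (Neg t)) [?N, p] [] = 0" using t(2) by (simp add: val_Neg)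
    then have "kleene (index (Neg (Neg t))) [?N, p] [] [G] [exists3] 0"
      using kleene_index[of "[?N, p]" "[]" "Neg (Neg t)" G] scoped_mono[OF t(1), of "Suc (Suc 0)"]
      by (simp del: index.simps)
    moreover have "kleene (index (Var 0)) [?N, p] [] [G] [exists3] ?N"
      using kleene_index[of "[?N, p]" "[]" "Var 0" G] by (simp del: index.simps)
    ultimately show ?case
      by (subst p_def) (rule S4, assumption, rule S5_0)
  next
    case (step n)
    have "\<not> P G n" using step(2) not_less_Least by blast
    then have "val G (Neg (Neg t)) [n, p] [] = Suc 0" using t(2) by (simp add: val_Neg)
    then have "kleene (index (Neg (Neg t))) [n, p] [] [G] [exists3] (Suc 0)"
      using kleene_index[of "[n, p]" "[]" "Neg (Neg t)" G] scoped_mono[OF t(1), of "Suc (Suc 0)"]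
      by (simp del: index.simps)
    moreover have "kleene (index (Var 0)) [n, p] [] [G] [exists3] n"
      using kleene_index[of "[n, p]" "[]" "Var 0" G] by (simp del: index.simps)
    then have "kleene (list_encode [5, index (Var 0), again]) [Suc 0, n, p] [] [G] [exists3]
      (LEAST n. P G n)"
      by (intro S5_Suc S5_0 again step(3))
    ultimately show ?case
      by (subst p_def) (rule S4)
  qed
  have "kleene start xs [] [G] [exists3] (LEAST n. P G n)" for xs G
  proof -
    have const: "kleene (index (Const c)) ys [] [G] [exists3] c" for c ys
      unfolding index.simps by (rule S2)
    show ?thesis
      unfolding start_def
      by (rule S4[OF const], rule S4[OF const], rule S4[OF const], rule call, rule p) simp
  qed
  then show ?thesis by blast
qed

section \<open>Computing the special fan functional\<close>

text \<open>Codes a nonempty countable set of sequences by one sequence, so that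
  \<open>exists3\<close> can quantify over such sets.\<close>

definition rows :: "type1 \<Rightarrow> type1 set" where
  "rows h = range (\<lambda>i n. h (prod_encode (i, n)))"

text \<open>Since \<open>W G\<close> is countable and good, it is itself of the form
  \<open>rows h\<close>; restricting the union to countable good sets loses nothing.\<close>

lemma W_iff: "a \<in> W G \<longleftrightarrow> (\<exists>h. good G (rows h) \<and> a \<in> rows h)"
proof
  assume a: "a \<in> W G"
  define h where "h k = (case prod_decode k of (i, n) \<Rightarrow> point G i n)" for k
  have "rows h = W G" by (simp add: rows_def h_def W_eq_range_point)
  then show "\<exists>h. good G (rows h) \<and> a \<in> rows h" using a good_W by metis
qed (auto simp: W_def)

text \<open>The parameters are positions in the function environment outside the formula; each
  quantifier crossed, also over numbers, adds a \<open>Suc\<close>.\<close>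

definition Lex_less :: "nat \<Rightarrow> nat \<Rightarrow> tm" where
  "Lex_less a b = ExN (Add (Less (FApp (Suc a) (Var 0)) (FApp (Suc b) (Var 0)))
     (AllN (Imp (Less (Var 0) (Var 1))
       (Eq (FApp (Suc (Suc a)) (Var 0)) (FApp (Suc (Suc b)) (Var 0))))))"

definition Covers :: "nat \<Rightarrow> nat \<Rightarrow> tm" where
  "Covers b x = AllN (Imp (Less (Var 0) (GApp (FApp (Suc b) (Var 0))))
     (Eq (FApp (Suc x) (Var 0)) (FApp (Suc b) (Var 0))))"

definition Right_covers :: "nat \<Rightarrow> nat \<Rightarrow> tm" where
  "Right_covers b x = Add (Neg (Lex_less x b)) (Covers b x)"

definition Binary :: "nat \<Rightarrow> tm" where
  "Binary a = AllN (Less (FApp (Suc a) (Var 0)) (Const 2))"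

definition Row :: "nat \<Rightarrow> nat \<Rightarrow> tm" where
  "Row a h = ExN (AllN (Eq (FApp (Suc (Suc a)) (Var 0))
     (FApp (Suc (Suc h)) (Encode_pair (Var 1) (Var 0)))))"

definition Good :: "nat \<Rightarrow> tm" where
  "Good h = All (Imp (Row 0 (Suc h)) (Add (Binary 0) (Add
     (All (Imp (Binary 0) (Imp (Lex_less 0 1)
       (Ex (Add (Row 0 (Suc (Suc (Suc h)))) (Right_covers 0 1))))))
     (All (Imp (Row 0 (Suc (Suc h))) (Imp (Lex_less 0 1) (Neg (Covers 0 1))))))))"

text \<open>The first conjunct is membership in \<open>W G\<close> by \<open>W_iff\<close>. As
  \<open>Right_covers\<close> takes only function variables, the sequence \<open>ev_one\<close> is
  first introduced as a quantified function.\<close>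

definition Point :: "nat \<Rightarrow> nat \<Rightarrow> tm" where
  "Point b i = Add (Ex (Add (Good 0) (Row (Suc b) 0)))
     (Ex (Add (AllN (Eq (FApp 1 (Var 0)) (Ev_one (Var (Suc i)) (Var 0))))
       (Right_covers (Suc b) 0)))"

text \<open>In \<open>Covers 0 2\<close>, position 1 is skipped because it holds the dummy function
  of \<open>ExN\<close>.\<close>

definition Subcover :: tm where
  "Subcover = All (Imp (Binary 0)
     (ExN (Add (Less (Var 0) (Var 1)) (Ex (Add (Point 0 0) (Covers 0 2))))))"

text \<open>The arguments are the length, the position and the place. Here the value counts, not the
  truth: points are binary, so \<open>Neg\<close> returns the entry itself, and 0 beyond the
  length.\<close>

definition Entry :: tm where
  "Entry = Neg (Add (Less (Var 1) (Var 0)) (Ex (Add (Point 0 1) (Eq (FApp 0 (Var 2)) (Const 1)))))"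

lemma holds_Lex_less [simp]: "holds G (Lex_less a b) xs fs \<longleftrightarrow> lex_less (fs ! a) (fs ! b)"
proof -
  have "holds G (AllN (Imp (Less (Var 0) (Var 1))
      (Eq (FApp (Suc (Suc a)) (Var 0)) (FApp (Suc (Suc b)) (Var 0))))) (n # xs) (f # fs) \<longleftrightarrow>
    (\<forall>m. m < n \<longrightarrow> (fs ! a) m = (fs ! b) m)" for n f
    by (rule holds_AllN) simp
  then show ?thesis
    unfolding Lex_less_def lex_less_def by (intro holds_ExN) simp
qed

lemma holds_Covers [simp]: "holds G (Covers b x) xs fs \<longleftrightarrow> covers G (fs ! b) (fs ! x)"
  unfolding Covers_def covers_def by (rule holds_AllN) simp

lemma holds_Right_covers [simp]:
  "holds G (Right_covers b x) xs fs \<longleftrightarrow> right_covers G (fs ! b) (fs ! x)"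
  unfolding Right_covers_def right_covers_def by simp

lemma holds_Binary [simp]: "holds G (Binary a) xs fs \<longleftrightarrow> fs ! a \<in> cantor_space"
proof -
  have "holds G (Binary a) xs fs \<longleftrightarrow> (\<forall>n. (fs ! a) n < 2)"
    unfolding Binary_def by (rule holds_AllN) simp
  then show ?thesis by (auto simp: cantor_space_def less_2_cases_iff)
qed

lemma holds_Row [simp]: "holds G (Row a h) xs fs \<longleftrightarrow> fs ! a \<in> rows (fs ! h)"
proof -
  have "holds G (Row a h) xs fs \<longleftrightarrow> (\<exists>i. \<forall>n. (fs ! a) n = (fs ! h) (prod_encode (i, n)))"
    unfolding Row_def by (rule holds_ExN, rule holds_AllN) simp
  then show ?thesis by (auto simp: rows_def fun_eq_iff)
qed

lemma holds_Good [simp]: "holds G (Good h) xs fs \<longleftrightarrow> good G (rows (fs ! h))"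
  unfolding Good_def good_def by (simp add: Ball_def Bex_def)

lemma holds_Point [simp]: "holds G (Point b i) xs fs \<longleftrightarrow> fs ! b = point G (xs ! i)"
proof -
  have "holds G (AllN (Eq (FApp 1 (Var 0)) (Ev_one (Var (Suc i)) (Var 0)))) xs (q # fs) \<longleftrightarrow>
    q = ev_one (xs ! i)" for q
    unfolding fun_eq_iff by (rule holds_AllN) simp
  then show ?thesis unfolding Point_def point_iff W_iff by simp
qed

lemma holds_Subcover: "holds G Subcover (N # ys) [] \<longleftrightarrow> subcover G N"
proof -
  have "holds G (ExN (Add (Less (Var 0) (Var 1)) (Ex (Add (Point 0 0) (Covers 0 2)))))
      (N # ys) [x] \<longleftrightarrow> (\<exists>i. i < N \<and> covers G (point G i) x)" for x
    by (rule holds_ExN) simp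
  then show ?thesis unfolding Subcover_def subcover_def by auto
qed

lemma val_Entry: "val G Entry [N, i, n] [] = (if i < N then point G i n else 0)"
proof -
  have "point G i \<in> cantor_space" using point_iff good_W[of G] unfolding good_def by blast
  then have "point G i n = 0 \<or> point G i n = 1" by (auto simp: cantor_space_def)
  then show ?thesis by (auto simp: Entry_def val_Neg)
qed

lemma scoped_formulas [simp]:
  "scoped m k (Lex_less a b) \<longleftrightarrow> a < k \<and> b < k"
  "scoped m k (Covers a b) \<longleftrightarrow> a < k \<and> b < k"
  "scoped m k (Right_covers a b) \<longleftrightarrow> a < k \<and> b < k"
  "scoped m k (Binary a) \<longleftrightarrow> a < k"
  "scoped m k (Row a b) \<longleftrightarrow> a < k \<and> b < k"
  "scoped m k (Good a) \<longleftrightarrow> a < k"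
  "scoped m k (Point a i) \<longleftrightarrow> a < k \<and> i < m"
  by (auto simp: Lex_less_def Covers_def Right_covers_def Binary_def Row_def Good_def Point_def)

theorem theorem3p9:
  "\<exists>\<Theta> :: type2 \<Rightarrow> type1 list. SFF \<Theta> \<and> seq_functional_computable_from \<Theta> exists3"
proof (intro exI conjI)
  show "SFF sfan" by (rule SFF_sfan)
  have "scoped 1 0 Subcover" by (simp add: Subcover_def)
  then obtain e where
    e: "\<And>G xs. kleene e xs [] [G] [exists3] (LEAST N. subcover G N)"
    using kleene_Least[OF _ holds_Subcover subcover_exists] by blast
  have "kleene (list_encode [4, index Entry, e]) [i, n] [] [G] [exists3]
      (if i < length (sfan G) then (sfan G ! i) n else 0)" for G i n
  \<comment> \<open>The search for the length ignores \<open>i\<close> and \<open>n\<close>; S4 then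
    puts its result in front of them, as \<open>Entry\<close> expects.\<close>
  proof (rule S4[OF e])
    have "kleene (index Entry) [LEAST N. subcover G N, i, n] [] [G] [exists3]
        (val G Entry [LEAST N. subcover G N, i, n] [])"
      by (rule kleene_index) (simp add: Entry_def)
    then show "kleene (index Entry) [LEAST N. subcover G N, i, n] [] [G] [exists3]
        (if i < length (sfan G) then (sfan G ! i) n else 0)"
      by (simp add: val_Entry sfan_def cong: if_cong)
  qed
  moreover have "kleene e [] [] [G] [exists3] (length (sfan G))" for G
    using e by (simp add: sfan_def)
  ultimately show "seq_functional_computable_from sfan exists3"
    unfolding seq_functional_computable_from_def by blast
qed

end
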